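(* Let $\Lambda=\Lambda_1+\dots+\Lambda_s\subset\mathbb{P}^n$ be a configuration of linear spaces with defining ideal $I\subset S=\mathbb{C}[x_0,\dots,x_n]$ and with $\dim\Lambda_i=n_i$. For each $i=1,\dots,s$ let $l_{i,0},\dots,l_{i,n_i}\in T_1$ be linear forms such that the degree $1$ piece of $(l_{i,0},\dots,l_{i,n_i})^\perp$ generates the ideal of $\Lambda_i$. Then, for any $d$, $$(I^\perp)_d=\left(\mathbb{C}[l_{1,0},\dots,l_{1,n_1}]\right)_d+\dots+\left(\mathbb{C}[l_{s,0},\dots,l_{s,n_s}]\right)_d .$$
   Context: $S=\mathbb{C}[x_0,\dots,x_n]$ is the homogeneous coordinate ring of $\mathbb{P}^n$ and $T=\mathbb{C}[y_0,\dots,y_n]$; $S_d$, $T_d$ are their homogeneous pieces of degree $d$. $T$ is an $S$-module by letting $x_i$ act as partial differentiation $\partial/\partial y_i$. For a homogeneous ideal $I\subset S$, $I^\perp\subset T$ is the $S$-submodule of elements of $T$ annihilated by every element of $I$, and $(I^\perp)_d=I^\perp\cap T_d$. For linear forms $l_0,\dots,l_k\in T_1$, the degree $1$ piece of $(l_0,\dots,l_k)^\perp$ is the space of linear forms in $S_1$ annihilating all of $l_0,\dots,l_k$ under this action. $\left(\mathbb{C}[l_{i,0},\dots,l_{i,n_i}]\right)_d$ is the degree $d$ part of the subring of $T$ generated over $\mathbb{C}$ by $l_{i,0},\dots,l_{i,n_i}$. A configuration of linear spaces $\Lambda=\Lambda_1+\dots+\Lambda_s$ is a finite union of distinct linear subspaces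 $\Lambda_i$ of $\mathbb{P}^n$ with $0\le\dim\Lambda_i<n$; its defining ideal is the ideal of all polynomials vanishing on it. *)

theory Defs
  imports "HOL-Analysis.Analysis" "HOL-Library.Poly_Mapping" "HOL-Library.Set_Algebras"
begin

section \<open>Polynomials\<close>

text \<open>
  Complex polynomials in variables indexed by the finite type \<open>'v\<close>, as finitely supported maps from
  exponent vectors to coefficients. With \<open>CARD('v) = n + 1\<close> the type plays both the role of
  \<open>S = \<complex>[x\<^sub>0,\<dots>,x\<^sub>n]\<close> and that of \<open>T = \<complex>[y\<^sub>0,\<dots>,y\<^sub>n]\<close>.
\<close>

type_synonym 'v mpoly = "('v \<Rightarrow>\<^sub>0 nat) \<Rightarrow>\<^sub>0 complex"

definition Const :: "complex \<Rightarrow> 'v mpoly"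
  where "Const c = Poly_Mapping.single 0 c"

definition Var :: "'v \<Rightarrow> 'v mpoly"
  where "Var v = Poly_Mapping.single (Poly_Mapping.single v 1) 1"

definition eval :: "'v::finite mpoly \<Rightarrow> complex ^ 'v \<Rightarrow> complex"
  where "eval f x = (\<Sum>m\<in>Poly_Mapping.keys f. Poly_Mapping.lookup f m * (\<Prod>v\<in>UNIV. (x $ v) ^ Poly_Mapping.lookup m v))"

definition homog :: "nat \<Rightarrow> 'v::finite mpoly set"
  where "homog d = {f. \<forall>m\<in>Poly_Mapping.keys f. (\<Sum>v\<in>UNIV. Poly_Mapping.lookup m v) = d}"

text \<open>The submodules of a commutative ring over itself are its ideals, and
  \<open>ideal.span G\<close> is the ideal generated by \<open>G\<close>.\<close>

interpretation ideal: module "(*) :: 'a::comm_ring_1 \<Rightarrow> 'a \<Rightarrow> 'a"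
  by unfold_locales (simp_all add: algebra_simps)

definition subalgebra :: "'v mpoly set \<Rightarrow> bool"
  where "subalgebra R \<longleftrightarrow> range Const \<subseteq> R \<and> (\<forall>f\<in>R. \<forall>g\<in>R. f + g \<in> R \<and> f * g \<in> R)"

text \<open>\<open>\<complex>[L]\<close>, for a set \<open>L\<close> of polynomials\<close>

definition generated_subalgebra :: "'v mpoly set \<Rightarrow> 'v mpoly set"
  where "generated_subalgebra L = subalgebra hull L"


section \<open>The action of \<open>S\<close> on \<open>T\<close> by differentiation\<close>

text \<open>Truncated subtraction on exponents is harmless: the coefficient vanishes when it truncates.\<close>

definition partial :: "'v \<Rightarrow> 'v mpoly \<Rightarrow> 'v mpoly"
  where "partial v g = (\<Sum>k\<in>Poly_Mapping.keys g.
    Poly_Mapping.single (k - Poly_Mapping.single v 1)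
      (of_nat (Poly_Mapping.lookup k v) * Poly_Mapping.lookup g k))"

text \<open>The order in which the fold composes the operators is irrelevant,
  by \<open>partial_commute\<close> below.\<close>

definition partial_monom :: "('v::finite \<Rightarrow>\<^sub>0 nat) \<Rightarrow> 'v mpoly \<Rightarrow> 'v mpoly"
  where "partial_monom m g = Finite_Set.fold (\<lambda>v. partial v ^^ Poly_Mapping.lookup m v) g UNIV"

definition act :: "'v::finite mpoly \<Rightarrow> 'v mpoly \<Rightarrow> 'v mpoly"
  where "act f g = (\<Sum>m\<in>Poly_Mapping.keys f. Const (Poly_Mapping.lookup f m) * partial_monom m g)"

text \<open>Annihilators on either side of the action: \<open>perp I \<subseteq> T\<close> for \<open>I \<subseteq> S\<close>, and
  \<open>annihilator F \<subseteq> S\<close> for \<open>F \<subseteq> T\<close>.\<close>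

definition perp :: "'v::finite mpoly set \<Rightarrow> 'v mpoly set"
  where "perp I = {g. \<forall>f\<in>I. act f g = 0}"

definition annihilator :: "'v::finite mpoly set \<Rightarrow> 'v mpoly set"
  where "annihilator F = {f. \<forall>g\<in>F. act f g = 0}"


section \<open>Linear subspaces of projective space\<close>

text \<open>A point of \<open>\<P>\<^sup>n\<close> is a line through the origin in \<open>\<complex>\<^sup>n\<^sup>+\<^sup>1\<close>.\<close>

definition projectivization :: "(complex ^ 'v::finite) set \<Rightarrow> (complex ^ 'v) set set"
  where "projectivization W = {vec.span {x} | x. x \<in> W \<and> x \<noteq> 0}"

definition proj_linear_space :: "nat \<Rightarrow> (complex ^ 'v::finite) set set \<Rightarrow> bool"
  where "proj_linear_space k X \<longleftrightarrow>
    (\<exists>W. vec.subspace W \<and> vec.dim W = k + 1 \<and> X = projectivization W)"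

text \<open>A polynomial vanishes at a point when it vanishes at all its representatives; over \<open>\<complex>\<close>
  this forces every homogeneous component to vanish there, so the ideal is homogeneous.\<close>

definition vanishing_ideal :: "(complex ^ 'v::finite) set set \<Rightarrow> 'v mpoly set"
  where "vanishing_ideal X = {f. \<forall>x. x \<noteq> 0 \<and> vec.span {x} \<in> X \<longrightarrow> eval f x = 0}"


section \<open>The action is a module action extending partial differentiation\<close>

lemma lookup_partial:
  "Poly_Mapping.lookup (partial v g) k =
    of_nat (Poly_Mapping.lookup k v + 1) * Poly_Mapping.lookup g (k + Poly_Mapping.single v 1)"
proof -
  let ?e = "Poly_Mapping.single v (1::nat)"
  have *: "(of_nat (Poly_Mapping.lookup k' v) * Poly_Mapping.lookup g k' when k' - ?e = k)
     = (if k' = k + ?e then of_nat (Poly_Mapping.lookup k v + 1) * Poly_Mapping.lookup g k' else 0)" for k'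
  proof (cases "k' = k + ?e")
    case True
    then show ?thesis by (simp add: lookup_add)
  next
    case False
    have "Poly_Mapping.lookup k' v = 0" if "k' - ?e = k"
    proof (rule ccontr)
      assume "Poly_Mapping.lookup k' v \<noteq> 0"
      then have "k' - ?e + ?e = k'"
        by (intro poly_mapping_eqI) (auto simp: lookup_add lookup_minus lookup_single when_def)
      with that False show False by simp
    qed
    with False show ?thesis by (auto simp: when_def)
  qed
  show ?thesis
    unfolding partial_def lookup_sum lookup_single *
    by (simp add: in_keys_iff)
qed

lemma partial_commute: "partial v (partial w g) = partial w (partial v g)"
  by (rule poly_mapping_eqI)
     (auto simp: lookup_partial lookup_add lookup_single when_def add.commute add.left_commute)

lemma partial_add: "partial v (f + g) = partial v f + partial v g"
  by (rule poly_mapping_eqI) (simp add: lookup_partial lookup_add algebra_simps)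

lemma lookup_Const_mult: "Poly_Mapping.lookup (Const c * f) k = c * Poly_Mapping.lookup f k"
  unfolding Const_def mult_map_scale_conv_mult[symmetric]
  by (simp add: Poly_Mapping.map.rep_eq when_def)

lemma Const_mult: "Const (a * b) = Const a * Const b"
  by (simp add: Const_def mult_single)

lemma Const_add: "Const (a + b) = Const a + Const b"
  by (simp add: Const_def single_add)

lemma Const_0: "Const 0 = 0"
  by (simp add: Const_def)

lemma Const_1: "Const 1 = 1"
  by (simp add: Const_def)

lemma partial_Const_mult: "partial v (Const c * f) = Const c * partial v f"
  by (rule poly_mapping_eqI) (simp add: lookup_partial lookup_Const_mult)

lemma partial_funpow_commute: "(partial v ^^ a) ((partial w ^^ b) g) = (partial w ^^ b) ((partial v ^^ a) g)"
proof -
  have 1: "partial v ((partial w ^^ b) g) = (partial w ^^ b) (partial v g)" for g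
    by (induction b) (simp_all add: partial_commute[of v w])
  show ?thesis by (induction a) (simp_all add: 1)
qed

lemma comp_fun_commute_partial: "comp_fun_commute (\<lambda>v. partial v ^^ e v)"
  by unfold_locales (auto simp: fun_eq_iff partial_funpow_commute)

lemma fold_partial_insert:
  assumes "finite A" "x \<notin> A"
  shows "Finite_Set.fold (\<lambda>v. partial v ^^ e v) g (insert x A) =
    (partial x ^^ e x) (Finite_Set.fold (\<lambda>v. partial v ^^ e v) g A)"
proof -
  interpret comp_fun_commute "\<lambda>v. partial v ^^ e v" by (rule comp_fun_commute_partial)
  show ?thesis by (rule fold_insert[OF assms])
qed

lemma fold_partial_invariant:
  assumes "finite A" and "\<And>v h. F (partial v h) = partial v (F h)"
  shows "F (Finite_Set.fold (\<lambda>v. partial v ^^ e v) g A) = Finite_Set.fold (\<lambda>v. partial v ^^ e v) (F g) A"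
proof -
  interpret comp_fun_commute "\<lambda>v. partial v ^^ e v" by (rule comp_fun_commute_partial)
  have *: "F ((partial v ^^ k) h) = (partial v ^^ k) (F h)" for v k h
    by (induction k) (simp_all add: assms(2))
  show ?thesis using assms(1) by induction (simp_all add: *)
qed

lemma partial_monom_partial: "partial_monom m (partial v g) = partial v (partial_monom m g)"
  unfolding partial_monom_def
  by (rule fold_partial_invariant[symmetric]) (simp_all add: partial_commute)

lemma partial_monom_Const_mult: "partial_monom m (Const c * g) = Const c * partial_monom m g"
  unfolding partial_monom_def
  by (rule fold_partial_invariant[where F="\<lambda>h. Const c * h", symmetric]) (simp_all add: partial_Const_mult)

lemma partial_monom_plus: "partial_monom (a + b) g = partial_monom a (partial_monom b g)"
proof -
  let ?A = "\<lambda>v. partial v ^^ Poly_Mapping.lookup a v"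
  let ?B = "\<lambda>v. partial v ^^ Poly_Mapping.lookup b v"
  let ?C = "\<lambda>v. partial v ^^ Poly_Mapping.lookup (a + b) v"
  interpret A: comp_fun_commute ?A by (rule comp_fun_commute_partial)
  interpret B: comp_fun_commute ?B by (rule comp_fun_commute_partial)
  interpret C: comp_fun_commute ?C by (rule comp_fun_commute_partial)
  have "Finite_Set.fold ?C g X = Finite_Set.fold ?A (Finite_Set.fold ?B g X) X" if "finite X" for X
    using that
  proof induction
    case (insert x X)
    have *: "?B x (Finite_Set.fold ?A h X) = Finite_Set.fold ?A (?B x h) X" for h
    proof (rule fold_partial_invariant[OF insert(1)])
      show "?B x (partial v h) = partial v (?B x h)" for v h
        using partial_funpow_commute[where v=x and w=v and b=1] by simp
    qed
    have "Finite_Set.fold ?C g (insert x X) = ?C x (Finite_Set.fold ?C g X)"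
      by (rule C.fold_insert[OF insert(1,2)])
    also have "\<dots> = ?A x (?B x (Finite_Set.fold ?A (Finite_Set.fold ?B g X) X))"
      by (subst insert.IH) (simp only: lookup_add funpow_add o_apply)
    also have "\<dots> = ?A x (Finite_Set.fold ?A (Finite_Set.fold ?B g (insert x X)) X)"
      by (simp only: * B.fold_insert[OF insert(1,2)])
    also have "\<dots> = Finite_Set.fold ?A (Finite_Set.fold ?B g (insert x X)) (insert x X)"
      by (rule A.fold_insert[OF insert(1,2), symmetric])
    finally show ?case .
  qed simp
  then show ?thesis by (simp add: partial_monom_def)
qed

lemma partial_monom_add: "partial_monom m (f + g) = partial_monom m f + partial_monom m g"
proof -
  interpret comp_fun_commute "\<lambda>v. partial v ^^ Poly_Mapping.lookup m v" by (rule comp_fun_commute_partial)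
  have *: "(partial v ^^ k) (f + g) = (partial v ^^ k) f + (partial v ^^ k) g" for v k and f g :: "'a mpoly"
    by (induction k) (simp_all add: partial_add)
  have "Finite_Set.fold (\<lambda>v. partial v ^^ Poly_Mapping.lookup m v) (f + g) X =
     Finite_Set.fold (\<lambda>v. partial v ^^ Poly_Mapping.lookup m v) f X +
     Finite_Set.fold (\<lambda>v. partial v ^^ Poly_Mapping.lookup m v) g X" if "finite X" for X
    using that by induction (simp_all add: *)
  then show ?thesis by (simp add: partial_monom_def)
qed

lemma partial_monom_0: "partial_monom 0 g = g"
proof -
  have "Finite_Set.fold (\<lambda>v. partial v ^^ e v) g X = g" if "finite X" "\<And>v. e v = 0"
    for X :: "'a set" and e
    using that(1)
  proof induction
    case (insert x X)
    show ?case
      by (rule trans[OF fold_partial_insert[OF insert(1,2)]]) (subst insert.IH, simp add: that(2))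
  qed simp
  then show ?thesis by (simp add: partial_monom_def)
qed

lemma partial_monom_single: "partial_monom (Poly_Mapping.single v 1) g = partial v g"
proof -
  let ?f = "\<lambda>w. partial w ^^ Poly_Mapping.lookup (Poly_Mapping.single v 1) w"
  interpret comp_fun_commute ?f by (rule comp_fun_commute_partial)
  have "Finite_Set.fold ?f h X = (if v \<in> X then partial v h else h)" if "finite X" for X h
    using that
  proof induction
    case (insert x X)
    then show ?case
      by (subst fold_insert; cases "x = v") (auto simp: lookup_single)
  qed simp
  then show ?thesis by (simp add: partial_monom_def)
qed

lemma act_superset:
  assumes "finite K" "Poly_Mapping.keys f \<subseteq> K"
  shows "act f g = (\<Sum>m\<in>K. Const (Poly_Mapping.lookup f m) * partial_monom m g)"
  unfolding act_def using assms
  by (intro sum.mono_neutral_left) (auto simp: in_keys_iff Const_0)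

lemma act_add_left: "act (f + f') g = act f g + act f' g"
proof -
  let ?K = "Poly_Mapping.keys f \<union> Poly_Mapping.keys f'"
  have "Poly_Mapping.keys (f + f') \<subseteq> ?K" by (rule Poly_Mapping.keys_add)
  then show ?thesis
    by (simp add: act_superset[of ?K] lookup_add Const_add distrib_right sum.distrib)
qed

lemma act_add_right: "act f (g + h) = act f g + act f h"
  by (simp add: act_def partial_monom_add distrib_left sum.distrib)

lemma act_single: "act (Poly_Mapping.single m c) g = Const c * partial_monom m g"
  by (simp add: act_superset[of "{m}"])

lemma act_0_left: "act 0 g = 0"
  by (simp add: act_def)

lemma act_Const: "act (Const c) g = Const c * g"
  using act_single[of 0 c g] by (simp only: partial_monom_0 flip: Const_def)

lemma act_1: "act 1 g = g"
  using act_Const[of 1 g] by (simp add: Const_1)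

lemma act_Var: "act (Var v) g = partial v g"
  by (simp add: Var_def act_single Const_1 partial_monom_single del: One_nat_def)

lemma act_mult: "act (f * f') g = act f (act f' g)"
proof -
  have single: "act (Poly_Mapping.single m c * Poly_Mapping.single m' c') g =
      act (Poly_Mapping.single m c) (act (Poly_Mapping.single m' c') g)" for m m' :: "'a \<Rightarrow>\<^sub>0 nat" and c c' g
    by (simp only: mult_single act_single partial_monom_plus partial_monom_Const_mult Const_mult mult.assoc)
  have ind: "P f" if "P 0" "\<And>m c. P (Poly_Mapping.single m c)" "\<And>f g. P f \<Longrightarrow> P g \<Longrightarrow> P (f + g)"
    for P and f :: "'a mpoly"
  proof (induction f rule: update_induct)
    case (update f a b)
    have "Poly_Mapping.update a b f = f + Poly_Mapping.single a b"
      by (rule poly_mapping_eqI)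
         (use update(1) in \<open>auto simp: lookup_update lookup_add lookup_single when_def in_keys_iff\<close>)
    with update that show ?case by simp
  qed (use that in simp)
  have left: "act (Poly_Mapping.single m c * f') g = act (Poly_Mapping.single m c) (act f' g)" for m c
  proof (induction f' rule: ind)
    case 1
    have "act (Poly_Mapping.single m c) 0 = 0"
      using act_add_right[of "Poly_Mapping.single m c" 0 0] by simp
    then show ?case by (simp add: act_0_left)
  qed (simp_all add: single distrib_left act_add_left act_add_right)
  show ?thesis
    by (induction f rule: ind) (simp_all add: act_0_left left distrib_right act_add_left)
qed

end

theory Submission
  imports Defs
begin

text \<open>
  A linear form in \<open>S\<^sub>1\<close> acts as a derivation, so one that kills \<open>l\<^bsub>i,0\<^esub>,\<dots>,l\<^bsub>i,n\<^sub>i\<^esub>\<close> kills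
  \<open>\<complex>[l\<^bsub>i,0\<^esub>,\<dots>,l\<^bsub>i,n\<^sub>i\<^esub>]\<close>; hence so does the ideal of \<open>\<Lambda>\<^sub>i\<close>, and with it \<open>I\<close>. Conversely, the pairing
  \<open>S\<^sub>d \<times> T\<^sub>d \<rightarrow> \<complex>\<close> given by the action is perfect, so a form of degree \<open>d\<close> outside the sum on the right
  is separated from it by some \<open>f \<in> S\<^sub>d\<close>. For a point \<open>x\<close> of \<open>\<Lambda>\<^sub>i\<close> the form \<open>L\<^sub>x = \<Sum> x\<^sub>v y\<^sub>v\<close> is a
  combination of the \<open>l\<^bsub>i,j\<^esub>\<close> (by the same separation in degree 1), so \<open>f\<close> kills \<open>L\<^sub>x\<^sup>d\<close>. As the action
  of \<open>f\<close> on \<open>L\<^sub>x\<^sup>d\<close> gives \<open>d! f(x)\<close>, the polynomial \<open>f\<close> vanishes on the configuration and lies in \<open>I\<close>.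
\<close>

text \<open>As a simplification rule this reassociates every product to the left and loops with
  \<open>mult.assoc\<close>.\<close>

declare ideal.scale_scale [simp del]

section \<open>Monomials and homogeneous polynomials\<close>

definition mdeg :: "('v::finite \<Rightarrow>\<^sub>0 nat) \<Rightarrow> nat"
  where "mdeg m = (\<Sum>v\<in>UNIV. Poly_Mapping.lookup m v)"

lemma mdeg_0 [simp]: "mdeg 0 = 0"
  by (simp add: mdeg_def)

lemma mdeg_single [simp]: "mdeg (Poly_Mapping.single v k) = k"
  by (simp add: mdeg_def lookup_single when_def)

lemma mdeg_add [simp]: "mdeg (a + b) = mdeg a + mdeg b"
  by (simp add: mdeg_def lookup_add sum.distrib)

lemma mdeg_eq_0_iff [simp]: "mdeg m = 0 \<longleftrightarrow> m = 0"
  by (auto simp: mdeg_def intro: poly_mapping_eqI)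

lemma mdeg_Suc_decompose:
  assumes "mdeg m = Suc k"
  obtains m' v where "m = m' + Poly_Mapping.single v 1" "mdeg m' = k"
proof -
  from assms have "\<exists>v. Poly_Mapping.lookup m v \<noteq> 0"
    by (metis mdeg_eq_0_iff lookup_zero poly_mapping_eqI nat.distinct(1))
  then obtain v where v: "Poly_Mapping.lookup m v \<noteq> 0" ..
  then have m: "m = (m - Poly_Mapping.single v 1) + Poly_Mapping.single v 1"
    by (intro poly_mapping_eqI) (auto simp: lookup_add lookup_minus lookup_single when_def)
  moreover from arg_cong[OF m, of mdeg] assms have "mdeg (m - Poly_Mapping.single v 1) = k"
    unfolding mdeg_add mdeg_single by simp
  ultimately show thesis by (rule that)
qed

lemma monomial_induct [case_names zero step]:
  assumes "P 0" and "\<And>m v. P m \<Longrightarrow> P (m + Poly_Mapping.single v 1)"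
  shows "P (m :: 'v::finite \<Rightarrow>\<^sub>0 nat)"
proof (induction "mdeg m" arbitrary: m)
  case 0
  then show ?case using assms(1) by (metis mdeg_eq_0_iff)
next
  case (Suc k)
  then show ?case by (metis mdeg_Suc_decompose assms(2))
qed

text \<open>A finitely supported map is a finite sum of \<open>single\<close> terms, so additive
  statements reduce to monomials.\<close>

lemma poly_mapping_add_induct [case_names zero single add]:
  assumes "P 0" and "\<And>m c. P (Poly_Mapping.single m c)" and "\<And>f g. P f \<Longrightarrow> P g \<Longrightarrow> P (f + g)"
  shows "P (f :: 'a \<Rightarrow>\<^sub>0 'b::comm_monoid_add)"
proof (induction f rule: update_induct)
  case (update f a b)
  have "Poly_Mapping.update a b f = f + Poly_Mapping.single a b"
    by (rule poly_mapping_eqI)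
       (use update(1) in \<open>auto simp: lookup_update lookup_add lookup_single when_def in_keys_iff\<close>)
  with update assms show ?case by simp
qed (use assms in simp)

text \<open>Every exponent is at most the total degree, so \<open>lookup\<close> embeds the set into
  a finite space of functions.\<close>

lemma finite_mdeg: "finite {m :: 'v::finite \<Rightarrow>\<^sub>0 nat. mdeg m = d}"
proof (rule finite_imageD)
  have "Poly_Mapping.lookup m v \<le> mdeg m" for m :: "'v \<Rightarrow>\<^sub>0 nat" and v
    unfolding mdeg_def by (rule member_le_sum) auto
  then have "Poly_Mapping.lookup ` {m :: 'v \<Rightarrow>\<^sub>0 nat. mdeg m = d} \<subseteq> UNIV \<rightarrow>\<^sub>E {..d}"
    by auto
  then show "finite (Poly_Mapping.lookup ` {m :: 'v \<Rightarrow>\<^sub>0 nat. mdeg m = d})"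
    by (rule finite_subset) (intro finite_PiE, auto)
qed (simp add: inj_on_def poly_mapping.lookup_inject)

lemma homog_iff: "f \<in> homog d \<longleftrightarrow> (\<forall>m. Poly_Mapping.lookup f m \<noteq> 0 \<longrightarrow> mdeg m = d)"
  by (auto simp: homog_def mdeg_def in_keys_iff)

lemma homog_0: "0 \<in> homog d"
  by (simp add: homog_iff)

lemma homog_add: "f \<in> homog d \<Longrightarrow> g \<in> homog d \<Longrightarrow> f + g \<in> homog d"
  unfolding homog_iff lookup_add by (metis add_0)

lemma homog_Const_mult: "f \<in> homog d \<Longrightarrow> Const c * f \<in> homog d"
  by (simp add: homog_iff lookup_Const_mult)

lemma homog_sum: "(\<And>i. i \<in> A \<Longrightarrow> f i \<in> homog d) \<Longrightarrow> sum f A \<in> homog d"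
  by (induction A rule: infinite_finite_induct) (simp_all add: homog_0 homog_add)

lemma homog_single: "mdeg m = d \<Longrightarrow> Poly_Mapping.single m c \<in> homog d"
  by (simp add: homog_iff lookup_single when_def)

lemma homog_mult:
  assumes "f \<in> homog a" "g \<in> homog b"
  shows "f * g \<in> homog (a + b)"
  unfolding homog_iff in_keys_iff[symmetric]
proof
  show "m \<in> Poly_Mapping.keys (f * g) \<longrightarrow> mdeg m = a + b" for m
    using keys_mult[of f g] assms[unfolded homog_iff in_keys_iff[symmetric]] by auto
qed

lemma homog_power: "f \<in> homog a \<Longrightarrow> f ^ k \<in> homog (k * a)"
proof (induction k)
  case 0
  then show ?case by (simp add: homog_single flip: single_one)
next
  case (Suc k)
  then show ?case by (simp add: homog_mult)
qed


section \<open>Subspaces of the polynomial ring\<close>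

interpretation mpoly: vector_space "\<lambda>c (f :: 'v mpoly). Const c * f"
  by unfold_locales (simp_all add: Const_add Const_mult Const_1 algebra_simps)

declare mpoly.scale_scale [simp del]

lemma subspace_homog: "mpoly.subspace (homog d)"
  by (simp add: mpoly.subspace_def homog_0 homog_add homog_Const_mult)

lemma act_0_right: "act f 0 = 0"
  using act_add_right[of f 0 0] by simp

text \<open>A scalar on \<open>T\<close> is the action of a constant, so this is commutativity of
  \<open>S\<close>.\<close>

lemma act_Const_mult_right: "act f (Const c * g) = Const c * act f g"
  by (metis act_Const act_mult mult.commute)

lemma subspace_perp: "mpoly.subspace (perp I)"
  by (simp add: mpoly.subspace_def perp_def act_add_right act_0_right act_Const_mult_right)

lemma subspace_set_sum:
  assumes "finite A" and "\<And>i. i \<in> A \<Longrightarrow> mpoly.subspace (V i)"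
  shows "mpoly.subspace (\<Sum>i\<in>A. V i)"
  using assms
proof (induction A)
  case empty
  then show ?case by (simp add: set_zero)
next
  case (insert i A)
  then have "mpoly.subspace {x + y | x y. x \<in> V i \<and> y \<in> (\<Sum>i\<in>A. V i)}"
    by (intro mpoly.subspace_sums) auto
  also have "{x + y | x y. x \<in> V i \<and> y \<in> (\<Sum>i\<in>A. V i)} = V i + (\<Sum>i\<in>A. V i)"
    by (auto simp: set_plus_def)
  finally show ?case using insert by simp
qed

lemma subset_set_sum:
  assumes "finite A" "i \<in> A" and "\<And>j. j \<in> A \<Longrightarrow> (0 :: 'a::comm_monoid_add) \<in> V j"
  shows "V i \<subseteq> (\<Sum>i\<in>A. V i)"
proof
  fix x assume "x \<in> V i"
  moreover have "x = (\<Sum>j\<in>A. if j = i then x else 0)"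
    using assms by simp
  ultimately show "x \<in> (\<Sum>i\<in>A. V i)"
    unfolding set_sum_alt[OF assms(1)] using assms(3)
    by (force intro!: exI[of _ "\<lambda>j. if j = i then x else 0"])
qed

lemma set_sum_subset_subspace:
  assumes "finite A" "mpoly.subspace U" and "\<And>i. i \<in> A \<Longrightarrow> V i \<subseteq> U"
  shows "(\<Sum>i\<in>A. V i) \<subseteq> U"
  unfolding set_sum_alt[OF assms(1)] using assms(2,3) by (blast intro: mpoly.subspace_sum)

lemma subspace_subalgebra:
  assumes "subalgebra R"
  shows "mpoly.subspace R"
proof -
  have "Const c \<in> R" for c using assms by (auto simp: subalgebra_def)
  with this[of 0] assms show ?thesis
    by (auto simp: mpoly.subspace_def subalgebra_def Const_0)
qed

lemma subalgebra_generated: "subalgebra (generated_subalgebra L)"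
  unfolding generated_subalgebra_def by (rule hull_in) (auto simp: subalgebra_def)

lemma subalgebra_power: "subalgebra R \<Longrightarrow> f \<in> R \<Longrightarrow> f ^ k \<in> R"
proof (induction k)
  case 0
  then show ?case by (metis Const_1 power_0 rangeI subalgebra_def subsetD)
qed (simp add: subalgebra_def)


section \<open>Leibniz rule\<close>

lemma partial_single:
  "partial v (Poly_Mapping.single m c) =
    Poly_Mapping.single (m - Poly_Mapping.single v 1) (of_nat (Poly_Mapping.lookup m v) * c)"
  by (cases "c = 0") (simp_all add: partial_def)

lemma partial_0: "partial v 0 = 0"
  by (simp add: partial_def)

text \<open>Both sides are biadditive, which leaves two monomials to check.\<close>

lemma partial_mult: "partial v (f * g) = f * partial v g + partial v f * g"
proof (induction f rule: poly_mapping_add_induct)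
  case (single m c)
  show ?case
  proof (induction g rule: poly_mapping_add_induct)
    case (single m' c')
    let ?e = "Poly_Mapping.single v (1::nat)"
    \<comment> \<open>Truncated subtraction passes into the second exponent: if
      \<open>lookup b v\<close> is 0 both coefficients vanish, otherwise nothing truncates.\<close>
    have shift: "Poly_Mapping.single (a + b - ?e) (of_nat (Poly_Mapping.lookup b v) * x) =
        Poly_Mapping.single (a + (b - ?e)) (of_nat (Poly_Mapping.lookup b v) * x)"
      for a b :: "'a \<Rightarrow>\<^sub>0 nat" and x :: complex
    proof (cases "Poly_Mapping.lookup b v = 0")
      case False
      then have "a + b - ?e = a + (b - ?e)"
        by (intro poly_mapping_eqI) (auto simp: lookup_add lookup_minus lookup_single when_def)
      then show ?thesis by simp
    qed simp
    have "partial v (Poly_Mapping.single m c * Poly_Mapping.single m' c') =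
        Poly_Mapping.single (m + m' - ?e) (of_nat (Poly_Mapping.lookup m' v) * (c * c')) +
        Poly_Mapping.single (m' + m - ?e) (of_nat (Poly_Mapping.lookup m v) * (c * c'))"
      by (simp only: mult_single partial_single lookup_add of_nat_add distrib_right single_add
          add.commute[of m' m]) (rule add.commute)
    also have "\<dots> = Poly_Mapping.single (m + (m' - ?e)) (of_nat (Poly_Mapping.lookup m' v) * (c * c')) +
        Poly_Mapping.single (m' + (m - ?e)) (of_nat (Poly_Mapping.lookup m v) * (c * c'))"
      by (simp only: shift)
    finally show ?case
      by (simp only: mult_single partial_single add.commute[of m'] mult.assoc mult.left_commute[of c])
  qed (simp_all add: partial_0 partial_add algebra_simps)
qed (simp_all add: partial_0 partial_add algebra_simps)

lemma partial_power: "partial v (f ^ Suc k) = of_nat (Suc k) * f ^ k * partial v f"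
proof (induction k)
  case 0
  show ?case by simp
next
  case (Suc k)
  have "partial v (f ^ Suc (Suc k)) = f * partial v (f ^ Suc k) + partial v f * f ^ Suc k"
    by (simp only: power_Suc[of f "Suc k"] partial_mult)
  then show ?case
    unfolding Suc by (simp add: algebra_simps)
qed

text \<open>A monomial of degree 1 acts as a single \<open>partial v\<close>, so a linear form acts
  as a derivation.\<close>

lemma act_mult_homog_1:
  assumes "a \<in> homog 1"
  shows "act a (f * g) = f * act a g + act a f * g"
proof -
  have "partial_monom m (f * g) = f * partial_monom m g + partial_monom m f * g"
    if m: "m \<in> Poly_Mapping.keys a" for m
  proof -
    from m assms have "mdeg m = Suc 0" by (simp add: homog_iff in_keys_iff)
    then obtain m' v where "m = m' + Poly_Mapping.single v 1" "mdeg m' = 0"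
      by (rule mdeg_Suc_decompose)
    then show ?thesis by (simp add: partial_monom_single partial_mult del: One_nat_def)
  qed
  then show ?thesis
    by (simp add: act_def sum_distrib_left sum_distrib_right algebra_simps sum.distrib)
qed

lemma act_homog_1_Const:
  assumes "a \<in> homog 1"
  shows "act a (Const c) = 0"
proof -
  \<comment> \<open>Leibniz for \<open>1 * 1\<close> gives
    \<open>act a 1 = act a 1 + act a 1\<close>.\<close>
  have "act a 1 = 0" using act_mult_homog_1[OF assms, of 1 1] by simp
  with act_Const_mult_right[of a c 1] show ?thesis by simp
qed

text \<open>The kernel of a derivation that kills constants is a subalgebra; here it contains
  \<open>L\<close>.\<close>

lemma act_generated_subalgebra:
  assumes "a \<in> annihilator L \<inter> homog 1" "g \<in> generated_subalgebra L"
  shows "act a g = 0"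
proof -
  have "generated_subalgebra L \<subseteq> {g. act a g = 0}"
    unfolding generated_subalgebra_def
    by (rule hull_minimal)
       (use assms(1) in \<open>auto simp: subalgebra_def annihilator_def act_add_right act_homog_1_Const act_mult_homog_1\<close>)
  with assms(2) show ?thesis by auto
qed

text \<open>The polynomials killing a fixed \<open>g\<close> form an ideal, so it suffices to check
  generators.\<close>

lemma generated_subalgebra_subset_perp:
  "generated_subalgebra L \<subseteq> perp (ideal.span (annihilator L \<inter> homog 1))"
proof
  fix g assume g: "g \<in> generated_subalgebra L"
  have "ideal.subspace {f. act f g = 0}"
    by (auto simp: ideal.subspace_def act_0_left act_add_left act_mult act_0_right)
  then have "ideal.span (annihilator L \<inter> homog 1) \<subseteq> {f. act f g = 0}"
    using act_generated_subalgebra[OF _ g] by (intro ideal.span_minimal) auto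
  then show "g \<in> perp (ideal.span (annihilator L \<inter> homog 1))"
    by (auto simp: perp_def)
qed


section \<open>The action on powers of linear forms\<close>

text \<open>The dual of evaluation at \<open>x\<close> in degree 1: linear forms act on it by their
  value at \<open>x\<close>.\<close>

definition lin_form :: "complex ^ 'v::finite \<Rightarrow> 'v mpoly"
  where "lin_form x = (\<Sum>v\<in>UNIV. Const (x $ v) * Var v)"

lemma lin_form_homog: "lin_form x \<in> homog 1"
  unfolding lin_form_def Var_def by (intro homog_sum homog_Const_mult homog_single) simp

lemma partial_lin_form: "partial v (lin_form x) = Const (x $ v)"
proof -
  have sum: "partial v (sum f A) = (\<Sum>a\<in>A. partial v (f a))" for f :: "'a \<Rightarrow> 'a mpoly" and A
    by (induction A rule: infinite_finite_induct) (simp_all add: partial_0 partial_add)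
  have Var: "partial v (Var w) = (if w = v then 1 else 0)" for w
    by (auto simp: Var_def partial_single lookup_single when_def)
  show ?thesis
    by (simp add: lin_form_def sum partial_Const_mult Var if_distrib cong: if_cong)
qed

lemma Const_eq_0_iff: "Const c = 0 \<longleftrightarrow> c = 0"
  by (metis Const_0 Const_def lookup_single_eq)

lemma of_nat_eq_Const: "of_nat k = Const (of_nat k)"
  by (induction k) (simp_all add: Const_0 Const_1 Const_add)

lemma partial_Const_lin_form_power:
  "partial v (Const c * lin_form x ^ Suc k) = Const (c * (of_nat (Suc k) * x $ v)) * lin_form x ^ k"
  unfolding partial_Const_mult partial_power partial_lin_form of_nat_eq_Const[of "Suc k"]
  by (simp only: Const_mult ac_simps)

text \<open>The quotient of factorials is the falling factorial produced by differentiating a power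
  \<open>mdeg m\<close> times. The surplus exponent \<open>k\<close> must vary: the induction step
  uses the hypothesis at \<open>Suc k\<close>, which keeps one factor for the extra
  derivative.\<close>

lemma partial_monom_lin_form_power:
  "partial_monom m (lin_form x ^ (mdeg m + k)) =
    Const (fact (mdeg m + k) / fact k * (\<Prod>v\<in>UNIV. (x $ v) ^ Poly_Mapping.lookup m v)) * lin_form x ^ k"
proof (induction m arbitrary: k rule: monomial_induct)
  case zero
  then show ?case by (simp add: partial_monom_0 Const_1)
next
  case (step m v)
  let ?c = "fact (mdeg m + Suc k) / fact (Suc k) * (\<Prod>v\<in>UNIV. (x $ v) ^ Poly_Mapping.lookup m v)"
  have "partial_monom (m + Poly_Mapping.single v 1) (lin_form x ^ (mdeg m + Suc k)) =
      partial v (Const ?c * lin_form x ^ Suc k)"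
    by (simp only: partial_monom_plus partial_monom_single partial_monom_partial step)
  also have "\<dots> = Const (?c * (of_nat (Suc k) * x $ v)) * lin_form x ^ k"
    by (rule partial_Const_lin_form_power)
  also have "?c * (of_nat (Suc k) * x $ v)
      = fact (mdeg m + Suc k) / fact k * (\<Prod>w\<in>UNIV. (x $ w) ^ Poly_Mapping.lookup (m + Poly_Mapping.single v 1) w)"
  proof -
    have "(\<Prod>w\<in>UNIV. (x $ w) ^ Poly_Mapping.lookup (Poly_Mapping.single v 1) w) = x $ v"
      by (subst prod.remove[of _ v]) (auto simp: lookup_single when_def intro!: prod.neutral)
    then show ?thesis
      by (simp add: lookup_add power_add prod.distrib field_simps del: of_nat_Suc One_nat_def)
  qed
  finally show ?case by simp
qed

text \<open>With no surplus exponent, each monomial of \<open>f\<close> contributes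
  \<open>fact d\<close> times its value at \<open>x\<close>.\<close>

lemma act_lin_form_power:
  assumes "f \<in> homog d"
  shows "act f (lin_form x ^ d) = Const (fact d * eval f x)"
proof -
  have Const_sum: "Const (sum h A) = (\<Sum>a\<in>A. Const (h a) :: 'a mpoly)" for h :: "('a \<Rightarrow>\<^sub>0 nat) \<Rightarrow> complex" and A
    by (induction A rule: infinite_finite_induct) (simp_all add: Const_0 Const_add)
  have "partial_monom m (lin_form x ^ d) = Const (fact d * (\<Prod>v\<in>UNIV. (x $ v) ^ Poly_Mapping.lookup m v))"
    if "m \<in> Poly_Mapping.keys f" for m
  proof -
    have "mdeg m = d" using assms that by (simp add: homog_iff in_keys_iff)
    with partial_monom_lin_form_power[of m x 0] show ?thesis by simp
  qed
  then show ?thesis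
    by (simp add: act_def eval_def Const_sum sum_distrib_left flip: Const_mult) (simp add: ac_simps)
qed


section \<open>The pairing in a fixed degree is perfect\<close>

text \<open>The factor is a product of falling factorials, nonzero in characteristic 0; this is what
  lets the pairing be inverted.\<close>

lemma lookup_partial_monom:
  "\<exists>C. (\<forall>k. C k \<noteq> 0) \<and> (\<forall>g k. Poly_Mapping.lookup (partial_monom m g) k = C k * Poly_Mapping.lookup g (k + m))"
proof (induction m rule: monomial_induct)
  case zero
  show ?case by (rule exI[of _ "\<lambda>_. 1"]) (simp add: partial_monom_0)
next
  case (step m v)
  then obtain C where C: "\<And>k. C k \<noteq> 0"
    "\<And>g k. Poly_Mapping.lookup (partial_monom m g) k = C k * Poly_Mapping.lookup g (k + m)"
    by blast
  have "of_nat (Poly_Mapping.lookup k v + 1) \<noteq> (0 :: complex)" for k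
    unfolding of_nat_eq_0_iff by simp
  then show ?case
    by (intro exI[of _ "\<lambda>k. C k * of_nat (Poly_Mapping.lookup (k + m) v + 1)"])
       (simp add: C partial_monom_plus partial_monom_single lookup_partial ac_simps
         del: One_nat_def of_nat_add of_nat_Suc add_Suc_right)
qed

text \<open>A basis of \<open>V\<close> stays independent when \<open>g\<close> is added, so a
  functional may be prescribed as 0 on the basis and 1 at \<open>g\<close>.\<close>

lemma exists_functional:
  assumes "mpoly.subspace V" "g \<notin> V"
  shows "\<exists>\<phi>. Vector_Spaces.linear (\<lambda>c f. Const c * f) (*) \<phi> \<and> (\<forall>p\<in>V. \<phi> p = 0) \<and> \<phi> g = (1 :: complex)"
proof -
  interpret pair: vector_space_pair "\<lambda>c (f :: 'a mpoly). Const c * f" "(*) :: complex \<Rightarrow> complex \<Rightarrow> complex"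
    by unfold_locales (simp_all add: algebra_simps)
  obtain B where B: "B \<subseteq> V" "mpoly.independent B" "V \<subseteq> mpoly.span B"
    by (rule mpoly.maximal_independent_subset)
  then have "g \<notin> mpoly.span B"
    using assms mpoly.span_minimal by blast
  with B have "mpoly.independent (insert g B)"
    by (intro mpoly.independent_insertI)
  from pair.linear_independent_extend[OF this, of "\<lambda>x. if x = g then 1 else 0"]
  obtain \<phi> where \<phi>: "Vector_Spaces.linear (\<lambda>c f. Const c * f) (*) \<phi>"
    "\<And>x. x \<in> insert g B \<Longrightarrow> \<phi> x = (if x = g then 1 else 0)"
    by blast
  have "\<phi> p = 0" if "p \<in> V" for p
  proof (rule pair.linear_eq_0_on_span[OF \<phi>(1)])
    show "\<phi> x = 0" if "x \<in> B" for x
      using that \<phi>(2) B(1) assms(2) by auto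
  qed (use that B(3) in auto)
  with \<phi> show ?thesis by auto
qed

text \<open>In degree \<open>d\<close> distinct monomials pair to 0, and a monomial \<open>m\<close>
  pairs with itself to a nonzero constant, so every functional can be written in the dual
  basis.\<close>

lemma functional_eq_act:
  fixes \<phi> :: "'v::finite mpoly \<Rightarrow> complex"
  assumes "Vector_Spaces.linear (\<lambda>c f. Const c * f) (*) \<phi>"
  shows "\<exists>f\<in>homog d. \<forall>p\<in>homog d. act f p = Const (\<phi> p)"
proof -
  interpret Vector_Spaces.linear "\<lambda>c f. Const c * f" "(*)" \<phi> by (rule assms)
  let ?M = "{m :: 'v \<Rightarrow>\<^sub>0 nat. mdeg m = d}"
  let ?y = "\<lambda>m :: 'v \<Rightarrow>\<^sub>0 nat. Poly_Mapping.single m (1 :: complex)"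
  obtain C where C: "\<And>m k. C m k \<noteq> 0"
    "\<And>m g k. Poly_Mapping.lookup (partial_monom (m :: 'v \<Rightarrow>\<^sub>0 nat) g) k = C m k * Poly_Mapping.lookup g (k + m)"
    using lookup_partial_monom by metis
  \<comment> \<open>\<open>C m 0\<close> is the constant to which \<open>partial_monom m\<close>
    sends \<open>?y m\<close>; dividing by it makes \<open>f\<close> act on \<open>?y m\<close> as
    \<open>\<phi> (?y m)\<close>.\<close>
  define f where "f = (\<Sum>m\<in>?M. Poly_Mapping.single m (\<phi> (?y m) / C m 0))"
  have f: "Poly_Mapping.lookup f m = (if m \<in> ?M then \<phi> (?y m) / C m 0 else 0)" for m
    by (simp add: f_def lookup_sum lookup_single when_def finite_mdeg)
  have "act f p = Const (\<phi> p)" if p: "p \<in> homog d" for p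
  proof (rule poly_mapping_eqI)
    fix k
    have "p = (\<Sum>m\<in>?M. Const (Poly_Mapping.lookup p m) * ?y m)"
      by (rule poly_mapping_eqI)
         (use p in \<open>auto simp: lookup_sum lookup_Const_mult lookup_single when_def finite_mdeg homog_iff if_distrib cong: if_cong\<close>)
    then have \<phi>p: "\<phi> p = (\<Sum>m\<in>?M. Poly_Mapping.lookup p m * \<phi> (?y m))"
      by (metis (no_types, lifting) sum scale sum.cong)
    have "act f p = (\<Sum>m\<in>?M. Const (\<phi> (?y m) / C m 0) * partial_monom m p)"
      by (subst act_superset[of ?M]) (auto simp: finite_mdeg f in_keys_iff split: if_splits)
    then have "Poly_Mapping.lookup (act f p) k =
        (\<Sum>m\<in>?M. \<phi> (?y m) / C m 0 * (C m k * Poly_Mapping.lookup p (k + m)))"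
      by (simp add: lookup_sum lookup_Const_mult C(2))
    also have "\<dots> = Poly_Mapping.lookup (Const (\<phi> p)) k"
    proof (cases "k = 0")
      case True
      then show ?thesis by (simp add: \<phi>p C(1) Const_def mult.commute)
    next
      \<comment> \<open>The exponent \<open>k + m\<close> has degree above \<open>d\<close>, so only
        the constant coefficient of \<open>act f p\<close> survives.\<close>
      case False
      then have "Poly_Mapping.lookup p (k + m) = 0" if "m \<in> ?M" for m
        using p that unfolding homog_iff by fastforce
      with False show ?thesis by (simp add: Const_def lookup_single when_def)
    qed
    finally show "Poly_Mapping.lookup (act f p) k = Poly_Mapping.lookup (Const (\<phi> p)) k" .
  qed
  moreover have "f \<in> homog d"
    by (simp add: homog_iff f)
  ultimately show ?thesis by blast
qed

text \<open>A functional vanishing on \<open>V\<close> but not at \<open>g\<close> is realized in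
  degree \<open>d\<close> by the action of a form.\<close>

lemma separation:
  assumes "mpoly.subspace V" "g \<in> homog d" "g \<notin> V"
  obtains f where "f \<in> homog d" "\<And>p. p \<in> V \<Longrightarrow> p \<in> homog d \<Longrightarrow> act f p = 0" "act f g \<noteq> 0"
proof -
  obtain \<phi> where \<phi>: "Vector_Spaces.linear (\<lambda>c f. Const c * f) (*) \<phi>"
    "\<And>p. p \<in> V \<Longrightarrow> \<phi> p = (0::complex)" "\<phi> g = 1"
    using exists_functional[OF assms(1,3)] by blast
  obtain f where f: "f \<in> homog d" "\<And>p. p \<in> homog d \<Longrightarrow> act f p = Const (\<phi> p)"
    using functional_eq_act[OF \<phi>(1)] by blast
  show thesis
    by (rule that[of f]) (simp_all add: f \<phi> Const_0 Const_1 assms(2))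
qed

text \<open>Otherwise separation gives a linear form \<open>f\<close> that kills \<open>L\<close>
  but not \<open>lin_form x\<close>; in degree 1 the latter says that \<open>eval f x\<close> is
  nonzero.\<close>

lemma lin_form_in_span:
  assumes "L \<subseteq> homog 1" "\<And>f. f \<in> annihilator L \<inter> homog 1 \<Longrightarrow> eval f x = 0"
  shows "lin_form x \<in> mpoly.span L"
proof (rule ccontr)
  assume "lin_form x \<notin> mpoly.span L"
  then obtain f where f: "f \<in> homog 1" "\<And>p. p \<in> mpoly.span L \<Longrightarrow> p \<in> homog 1 \<Longrightarrow> act f p = 0"
    "act f (lin_form x) \<noteq> 0"
    using separation[OF mpoly.subspace_span lin_form_homog] by metis
  then have "f \<in> annihilator L \<inter> homog 1"
    using assms(1) by (auto simp: annihilator_def mpoly.span_base)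
  then have "eval f x = 0" by (rule assms(2))
  with act_lin_form_power[OF f(1), of x] f(3) show False by (simp add: Const_0)
qed

section \<open>The inverse system of a configuration of linear spaces\<close>

theorem proposition5p3:
  fixes n s d :: nat
    and \<Lambda> :: "nat \<Rightarrow> (complex ^ 'v::finite) set set"
    and N :: "nat \<Rightarrow> nat"
    and l :: "nat \<Rightarrow> nat \<Rightarrow> 'v mpoly"
    and I :: "'v mpoly set"
  assumes "CARD('v) = n + 1"
    and "\<And>i. i \<in> {1..s} \<Longrightarrow> proj_linear_space (N i) (\<Lambda> i)"
    and "\<And>i. i \<in> {1..s} \<Longrightarrow> N i < n"
    and "inj_on \<Lambda> {1..s}"
    and "I = vanishing_ideal (\<Union>i\<in>{1..s}. \<Lambda> i)"
    and "\<And>i j. i \<in> {1..s} \<Longrightarrow> j \<le> N i \<Longrightarrow> l i j \<in> homog 1"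
    and "\<And>i. i \<in> {1..s} \<Longrightarrow>
      ideal.span (annihilator (l i ` {..N i}) \<inter> homog 1) = vanishing_ideal (\<Lambda> i)"
  shows "perp I \<inter> homog d = (\<Sum>i\<in>{1..s}. generated_subalgebra (l i ` {..N i}) \<inter> homog d)"
proof -
  let ?R = "\<lambda>i. generated_subalgebra (l i ` {..N i})"
  let ?V = "\<Sum>i\<in>{1..s}. ?R i \<inter> homog d"
  have sub: "mpoly.subspace (?R i \<inter> homog d)" for i
    by (intro mpoly.subspace_inter subspace_subalgebra subalgebra_generated subspace_homog)
  show ?thesis
  proof
    show "?V \<subseteq> perp I \<inter> homog d"
    proof (rule set_sum_subset_subspace)
      show "mpoly.subspace (perp I \<inter> homog d)"
        by (intro mpoly.subspace_inter subspace_perp subspace_homog)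
      show "?R i \<inter> homog d \<subseteq> perp I \<inter> homog d" if i: "i \<in> {1..s}" for i
      proof -
        \<comment> \<open>\<open>perp\<close> reverses inclusions, and vanishing on the whole
          configuration is stronger than on one component.\<close>
        have "I \<subseteq> vanishing_ideal (\<Lambda> i)"
          using i unfolding assms(5) vanishing_ideal_def by blast
        then have "perp (vanishing_ideal (\<Lambda> i)) \<subseteq> perp I"
          by (auto simp: perp_def)
        with generated_subalgebra_subset_perp[of "l i ` {..N i}"] show ?thesis
          unfolding assms(7)[OF i] by blast
      qed
    qed simp
    show "perp I \<inter> homog d \<subseteq> ?V"
    proof
      fix g assume g: "g \<in> perp I \<inter> homog d"
      show "g \<in> ?V"
      proof (rule ccontr)
        assume "g \<notin> ?V"
        moreover have "mpoly.subspace ?V"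
          by (rule subspace_set_sum) (simp_all add: sub)
        \<comment> \<open>The contradiction will come from \<open>f \<in> I\<close>, since
          \<open>g\<close> lies in \<open>perp I\<close> but is not killed by
          \<open>f\<close>.\<close>
        ultimately obtain f where f: "f \<in> homog d"
          "\<And>p. p \<in> ?V \<Longrightarrow> p \<in> homog d \<Longrightarrow> act f p = 0" "act f g \<noteq> 0"
          using separation g by blast
        have "eval f x = 0" if i: "i \<in> {1..s}" and x: "x \<noteq> 0" "vec.span {x} \<in> \<Lambda> i" for i x
        proof -
          let ?L = "l i ` {..N i}"
          \<comment> \<open>By hypothesis such an \<open>a\<close> is a generator of the ideal of
            \<open>\<Lambda> i\<close>.\<close>
          have "eval a x = 0" if "a \<in> annihilator ?L \<inter> homog 1" for a
            using ideal.span_base[OF that] x unfolding assms(7)[OF i] vanishing_ideal_def by blast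
          then have "lin_form x \<in> mpoly.span ?L"
            using assms(6)[OF i] by (intro lin_form_in_span) auto
          moreover have "mpoly.span ?L \<subseteq> ?R i"
            by (intro mpoly.span_minimal subspace_subalgebra subalgebra_generated)
               (auto simp: generated_subalgebra_def hull_inc)
          ultimately have "lin_form x ^ d \<in> ?R i"
            by (intro subalgebra_power subalgebra_generated) auto
          moreover have h: "lin_form x ^ d \<in> homog d"
            using homog_power[OF lin_form_homog, of x d] by simp
          moreover have "?R i \<inter> homog d \<subseteq> ?V"
            using i by (intro subset_set_sum mpoly.subspace_0 sub) auto
          ultimately have "act f (lin_form x ^ d) = 0"
            using f(2) by blast
          then have "Const (fact d * eval f x) = (0 :: 'v mpoly)"
            by (simp add: act_lin_form_power[OF f(1)])
          then show ?thesis
            by (simp add: Const_eq_0_iff)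
        qed
        then have "f \<in> I"
          unfolding assms(5) vanishing_ideal_def by blast
        with g f(3) show False
          by (auto simp: perp_def)
      qed
    qed
  qed
qed

end
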